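(* Let $P$ be a $2\times k$ zero-one matrix that does not contain a $2\times 2$ homogeneous submatrix. Then there is a constant $c>0$ such that every unordered $P$-free $n\times n$ zero-one matrix $A$ contains a homogeneous $cn\times cn$ submatrix.
   Context: A matrix is homogeneous if all its entries are equal. A submatrix of $A$ is the restriction of $A$ to a set of rows and a set of columns (in original order); an $s\times t$ submatrix has $s$ rows and $t$ columns. A zero-one matrix $A$ is unordered $P$-free if $A$ contains no submatrix whose rows and columns can be permuted to obtain $P$. Floors and ceilings are omitted. *)

theory Defs
  imports
    "HOL-Combinatorics.Permutations"
    "Jordan_Normal_Form.Matrix"
    "Jordan_Normal_Form.DL_Submatrix"
begin

definition zero_one_mat :: "int mat \<Rightarrow> bool" where
  "zero_one_mat A \<longleftrightarrow> elements_mat A \<subseteq> {0, 1}"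

definition homogeneous :: "'a mat \<Rightarrow> bool" where
  "homogeneous A \<longleftrightarrow> (\<forall>x\<in>elements_mat A. \<forall>y\<in>elements_mat A. x = y)"

text \<open>The library operation \<^const>\<open>submatrix\<close> keeps the selected rows and columns in their
  original order.\<close>

definition is_submatrix :: "'a mat \<Rightarrow> 'a mat \<Rightarrow> bool" where
  "is_submatrix B A \<longleftrightarrow>
     (\<exists>I J. I \<subseteq> {..<dim_row A} \<and> J \<subseteq> {..<dim_col A} \<and> B = submatrix A I J)"

definition permutable_to :: "'a mat \<Rightarrow> 'a mat \<Rightarrow> bool" where
  "permutable_to B P \<longleftrightarrow>
     (\<exists>p q. p permutes {..<dim_row B} \<and> q permutes {..<dim_col B} \<and>
        P = mat (dim_row B) (dim_col B) (\<lambda>(i, j). B $$ (p i, q j)))"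

definition unordered_free :: "'a mat \<Rightarrow> 'a mat \<Rightarrow> bool" where
  "unordered_free P A \<longleftrightarrow> \<not> (\<exists>B. is_submatrix B A \<and> permutable_to B P)"

definition has_homogeneous_submatrix :: "'a mat \<Rightarrow> nat \<Rightarrow> nat \<Rightarrow> bool" where
  "has_homogeneous_submatrix A s t \<longleftrightarrow>
     (\<exists>B. is_submatrix B A \<and> B \<in> carrier_mat s t \<and> homogeneous B)"

end

theory Submission
  imports Defs
begin

text \<open>View each row of \<open>A\<close> as the set of columns where it has a one. As \<open>P\<close> has at most one column
  of each constant type, being \<open>P\<close>-free forces any two row sets to be disjoint, to cover all columns,
  or to be almost nested (one is contained in the other up to fewer than \<open>K\<close> elements). After
  complementing all rows if necessary, half of the row sets have size at most \<open>n / 2\<close>, and then the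
  covering case is subsumed by the disjoint one. Choosing largest sets greedily gives pairwise
  disjoint tops such that every row set is almost contained in a top. The tops split into two
  groups, each covering at most \<open>3 n / 4\<close> columns; one of the groups almost contains half of the row
  sets, and any \<open>r\<close> of these miss at least \<open>n / 4 - r (K - 1)\<close> columns simultaneously.\<close>

section \<open>Almost laminar set families\<close>

text \<open>Greedy choice by induction: pick a set of largest size and discard all sets almost
  contained in it. Every remaining set is disjoint from the chosen one, so tops found among the
  remaining sets can be joined to it.\<close>

lemma ex_disjoint_tops:
  fixes F :: "'a \<Rightarrow> 'b set"
  assumes "finite I" "0 < k" "\<And>i. i \<in> I \<Longrightarrow> finite (F i)"
    and "\<And>i j. i \<in> I \<Longrightarrow> j \<in> I \<Longrightarrow> i \<noteq> j \<Longrightarrow>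
      F i \<inter> F j = {} \<or> card (F i - F j) < k \<or> card (F j - F i) < k"
  shows "\<exists>T\<subseteq>I. disjoint_family_on F T \<and> (\<forall>i\<in>I. \<exists>t\<in>T. card (F i - F t) < k)"
  using assms
proof (induction I rule: finite_psubset_induct)
  case (psubset I)
  show ?case
  proof (cases "I = {}")
    case True
    then show ?thesis by (auto simp: disjoint_family_on_def)
  next
    case False
    define m where "m = Max ((\<lambda>i. card (F i)) ` I)"
    have "m \<in> (\<lambda>i. card (F i)) ` I"
      unfolding m_def using False psubset.hyps by (intro Max_in) auto
    then obtain i where i: "i \<in> I" "card (F i) = m" by auto
    have max: "card (F j) \<le> card (F i)" if "j \<in> I" for j
      using that psubset.hyps i unfolding m_def by auto
    define J where "J = {j \<in> I. \<not> card (F j - F i) < k}"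
    have "i \<in> I - J" using i \<open>0 < k\<close> unfolding J_def by simp
    then have "J \<subset> I" unfolding J_def by blast
    then have "J \<subseteq> I" by blast
    have "\<exists>T\<subseteq>J. disjoint_family_on F T \<and> (\<forall>j\<in>J. \<exists>t\<in>T. card (F j - F t) < k)"
    proof (rule psubset.IH[OF \<open>J \<subset> I\<close> \<open>0 < k\<close>])
      show "finite (F j)" if "j \<in> J" for j
        using psubset.prems(2) \<open>J \<subseteq> I\<close> that by blast
      show "F i \<inter> F j = {} \<or> card (F i - F j) < k \<or> card (F j - F i) < k"
        if "i \<in> J" "j \<in> J" "i \<noteq> j" for i j
        using \<open>J \<subseteq> I\<close> that by (intro psubset.prems(3)) blast+
    qed
    then obtain T where T: "T \<subseteq> J" "disjoint_family_on F T"
      "\<And>j. j \<in> J \<Longrightarrow> \<exists>t\<in>T. card (F j - F t) < k"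
      by blast
    have disj: "F j \<inter> F i = {}" if "j \<in> J" for j
    proof -
      have j: "j \<in> I" "\<not> card (F j - F i) < k" using that unfolding J_def by auto
      then have "i \<noteq> j" using \<open>0 < k\<close> by auto
      \<comment> \<open>Both sets share the same intersection, so maximality of \<open>F i\<close>
        makes \<open>F i - F j\<close> at least as large as \<open>F j - F i\<close>. Neither
        difference is small, and only disjointness remains.\<close>
      have "card (F j) = card (F j \<inter> F i) + card (F j - F i)"
        using psubset.prems(2)[OF j(1)] by (simp add: card_Int_Diff)
      moreover have "card (F i) = card (F j \<inter> F i) + card (F i - F j)"
        using psubset.prems(2)[OF i(1)] by (metis card_Int_Diff inf_commute)
      ultimately have "\<not> card (F i - F j) < k" using max[OF j(1)] j(2) by linarith
      then show ?thesis using psubset.prems(3)[OF i(1) j(1) \<open>i \<noteq> j\<close>] j(2) by blast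
    qed
    show ?thesis
    proof (intro exI[of _ "insert i T"] conjI ballI)
      show "insert i T \<subseteq> I" using T(1) i unfolding J_def by auto
      show "disjoint_family_on F (insert i T)"
        using T(1,2) disj unfolding disjoint_family_on_def by blast
      show "\<exists>t\<in>insert i T. card (F j - F t) < k" if "j \<in> I" for j
        using that T(3)[of j] unfolding J_def by auto
    qed
  qed
qed

text \<open>Take \<open>S\<close> inclusion-maximal of weight at most 3n/4. If the rest weighed more
  than 3n/4, \<open>S\<close> would weigh less than n/4, and one more element of weight at most n/2
  would still fit.\<close>

lemma ex_balanced_split:
  fixes s :: "'a \<Rightarrow> nat"
  assumes "finite T" "sum s T \<le> n" "\<And>t. t \<in> T \<Longrightarrow> 2 * s t \<le> n"
  shows "\<exists>S\<subseteq>T. 4 * sum s S \<le> 3 * n \<and> 4 * sum s (T - S) \<le> 3 * n"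
proof -
  let ?P = "\<lambda>S. S \<subseteq> T \<and> 4 * sum s S \<le> 3 * n"
  have "finite {S. ?P S}" using assms(1) by simp
  moreover have "{S. ?P S} \<noteq> {}" by (auto intro!: exI[of _ "{}"])
  ultimately have "\<exists>S\<in>{S. ?P S}. \<forall>S'\<in>{S. ?P S}. S \<subseteq> S' \<longrightarrow> S = S'"
    by (rule finite_has_maximal)
  then obtain S where S: "?P S" "\<And>S'. ?P S' \<Longrightarrow> S \<subseteq> S' \<Longrightarrow> S = S'" by auto
  have "4 * sum s (T - S) \<le> 3 * n"
  proof (rule ccontr)
    assume *: "\<not> 4 * sum s (T - S) \<le> 3 * n"
    then have "T - S \<noteq> {}" by (intro notI) simp
    then obtain t where t: "t \<in> T - S" by blast
    have "sum s T = sum s S + sum s (T - S)"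
      using S(1) assms(1) by (metis add.commute sum.subset_diff)
    then have "4 * sum s S \<le> n" using * assms(2) by linarith
    moreover have "sum s (insert t S) = s t + sum s S"
      using t S(1) assms(1) finite_subset by (subst sum.insert) auto
    ultimately have "?P (insert t S)" using assms(3)[of t] t S(1) by auto
    then show False using S(2)[of "insert t S"] t by auto
  qed
  then show ?thesis using S(1) by blast
qed

lemma ex_few_sets_small_union:
  fixes F :: "'a \<Rightarrow> 'b set"
  assumes fin: "finite I" "finite V" and "0 < k"
    and sub: "\<And>i. i \<in> I \<Longrightarrow> F i \<subseteq> V" and half: "\<And>i. i \<in> I \<Longrightarrow> 2 * card (F i) \<le> card V"
    and laminar: "\<And>i j. i \<in> I \<Longrightarrow> j \<in> I \<Longrightarrow> i \<noteq> j \<Longrightarrow>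
      F i \<inter> F j = {} \<or> card (F i - F j) < k \<or> card (F j - F i) < k"
    and "2 * r \<le> card I" "4 * k * r \<le> card V"
  shows "\<exists>R\<subseteq>I. card R = r \<and> r \<le> card (V - \<Union> (F ` R))"
proof -
  have finF: "finite (F i)" if "i \<in> I" for i using sub[OF that] fin(2) finite_subset by blast
  have "\<exists>T\<subseteq>I. disjoint_family_on F T \<and> (\<forall>i\<in>I. \<exists>t\<in>T. card (F i - F t) < k)"
    by (rule ex_disjoint_tops[OF fin(1) \<open>0 < k\<close> finF laminar])
  then obtain T where T: "T \<subseteq> I" "disjoint_family_on F T"
      "\<And>i. i \<in> I \<Longrightarrow> \<exists>t\<in>T. card (F i - F t) < k"
    by blast
  have "finite T" using T(1) fin(1) finite_subset by blast
  have "(\<Sum>t\<in>T. card (F t)) = card (\<Union> (F ` T))"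
    using T(1,2) finF \<open>finite T\<close> unfolding disjoint_family_on_def
    by (subst card_UN_disjoint) auto
  also have "\<dots> \<le> card V" using T(1) sub fin(2) by (intro card_mono) auto
  finally have "\<exists>S\<subseteq>T. 4 * (\<Sum>t\<in>S. card (F t)) \<le> 3 * card V \<and>
      4 * (\<Sum>t\<in>T - S. card (F t)) \<le> 3 * card V"
    by (rule ex_balanced_split[OF \<open>finite T\<close>]) (rule half, rule subsetD[OF T(1)])
  then obtain S where S: "S \<subseteq> T" "4 * (\<Sum>t\<in>S. card (F t)) \<le> 3 * card V"
      "4 * (\<Sum>t\<in>T - S. card (F t)) \<le> 3 * card V"
    by blast
  define G where "G X = {i \<in> I. \<exists>t\<in>X. card (F i - F t) < k}" for X
  \<comment> \<open>Pigeonhole: each index has a top in one of the two groups, so one group serves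
    at least half of \<open>I\<close>.\<close>
  have "I = G S \<union> G (T - S)" using T(3) unfolding G_def by auto
  then have "card I \<le> card (G S) + card (G (T - S))" by (metis card_Un_le)
  then have "r \<le> card (G S) \<or> r \<le> card (G (T - S))" using \<open>2 * r \<le> card I\<close> by linarith
  then obtain X where X: "X \<subseteq> T" "4 * (\<Sum>t\<in>X. card (F t)) \<le> 3 * card V" "r \<le> card (G X)"
    using S that[of S] that[of "T - S"] by auto
  obtain R where R: "R \<subseteq> G X" "card R = r" "finite R"
    using obtain_subset_with_card_n[OF X(3)] by blast
  have "R \<subseteq> I" using R(1) unfolding G_def by auto
  have "finite X" using X(1) \<open>finite T\<close> finite_subset by blast
  have "\<forall>i\<in>R. \<exists>t. t \<in> X \<and> card (F i - F t) < k" using R(1) unfolding G_def by blast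
  then obtain t where t: "\<And>i. i \<in> R \<Longrightarrow> t i \<in> X" "\<And>i. i \<in> R \<Longrightarrow> card (F i - F (t i)) < k"
    by metis
  \<comment> \<open>The tops in \<open>X\<close> cover at most 3/4 of \<open>V\<close>, and each of
    the \<open>r\<close> sets adds at most \<open>k - 1\<close> points outside its top.\<close>
  have "\<Union> (F ` R) \<subseteq> \<Union> (F ` X) \<union> (\<Union>i\<in>R. F i - F (t i))" using t(1) by auto
  moreover have "finite (\<Union> (F ` X) \<union> (\<Union>i\<in>R. F i - F (t i)))"
    using \<open>finite X\<close> \<open>finite R\<close> finF X(1) T(1) \<open>R \<subseteq> I\<close> by auto
  ultimately have "card (\<Union> (F ` R)) \<le> card (\<Union> (F ` X) \<union> (\<Union>i\<in>R. F i - F (t i)))"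
    by (rule card_mono[rotated])
  also have "\<dots> \<le> card (\<Union> (F ` X)) + card (\<Union>i\<in>R. F i - F (t i))" by (rule card_Un_le)
  also have "\<dots> \<le> (\<Sum>t\<in>X. card (F t)) + (\<Sum>i\<in>R. card (F i - F (t i)))"
    by (intro add_mono card_UN_le \<open>finite X\<close> \<open>finite R\<close>)
  also have "(\<Sum>i\<in>R. card (F i - F (t i))) \<le> (\<Sum>i\<in>R. k - 1)"
    using t(2) by (intro sum_mono) (metis One_nat_def Suc_pred \<open>0 < k\<close> less_Suc_eq_le)
  also have "\<dots> = r * (k - 1)" using R(2) by simp
  finally have *: "card (\<Union> (F ` R)) \<le> (\<Sum>t\<in>X. card (F t)) + r * (k - 1)" by simp
  \<comment> \<open>The free quarter of \<open>V\<close> has at least \<open>k * r\<close> points: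
    \<open>r * (k - 1)\<close> pay for the overhangs and \<open>r\<close> stay uncovered.\<close>
  have "k * r = r * (k - 1) + r" using \<open>0 < k\<close> by (cases k) auto
  then have "card (\<Union> (F ` R)) + r \<le> card V" using * X(2) \<open>4 * k * r \<le> card V\<close> by linarith
  moreover have "\<Union> (F ` R) \<subseteq> V" using sub \<open>R \<subseteq> I\<close> by auto
  then have "card (V - \<Union> (F ` R)) = card V - card (\<Union> (F ` R))"
    by (intro card_Diff_subset finite_subset[OF _ fin(2)])
  ultimately show ?thesis using \<open>R \<subseteq> I\<close> R(2) by auto
qed

text \<open>Inclusion-exclusion leaves no room for an overlap. This turns the covering alternative
  into disjointness for sets of at most half the size.\<close>

lemma disjoint_of_cover_by_small:
  assumes "finite V" "A \<subseteq> V" "B \<subseteq> V" "2 * card A \<le> card V" "2 * card B \<le> card V" "A \<union> B = V"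
  shows "A \<inter> B = {}"
proof -
  have "finite A" "finite B"
    using finite_subset[OF assms(2,1)] finite_subset[OF assms(3,1)] by simp_all
  then have "card A + card B = card V + card (A \<inter> B)"
    using card_Un_Int[of A B] assms(6) by simp
  then have "card (A \<inter> B) = 0" using assms(4,5) by linarith
  then show ?thesis using \<open>finite A\<close> by simp
qed

text \<open>The hypothesis \<open>cross\<close> is invariant under complementing all sets:
  disjointness and covering swap, and so do the two differences. Hence the argument for small sets
  applies to whichever of the small or the large sets form at least half of the family.\<close>

lemma ex_large_rectangle_of_cross_free:
  fixes F :: "'a \<Rightarrow> 'b set"
  assumes fin: "finite I" "finite V" and "0 < k"
    and sub: "\<And>i. i \<in> I \<Longrightarrow> F i \<subseteq> V"
    and cross: "\<And>i j. i \<in> I \<Longrightarrow> j \<in> I \<Longrightarrow> i \<noteq> j \<Longrightarrow>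
      F i \<inter> F j = {} \<or> F i \<union> F j = V \<or> card (F i - F j) < k \<or> card (F j - F i) < k"
    and r: "4 * r \<le> card I" "4 * k * r \<le> card V"
  shows "\<exists>R\<subseteq>I. card R = r \<and> (r \<le> card (V - \<Union> (F ` R)) \<or> r \<le> card (V \<inter> \<Inter> (F ` R)))"
proof -
  define I0 where "I0 = {i \<in> I. 2 * card (F i) \<le> card V}"
  have I0: "I0 \<subseteq> I" "finite I0" "finite (I - I0)" using fin(1) unfolding I0_def by auto
  have "card I0 + card (I - I0) = card I"
    using I0 fin(1) by (simp add: card_Diff_subset card_mono)
  then consider "2 * r \<le> card I0" | "2 * r \<le> card (I - I0)" using r(1) by linarith
  then show ?thesis
  proof cases
    case 1
    have "F i \<inter> F j = {} \<or> card (F i - F j) < k \<or> card (F j - F i) < k"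
      if "i \<in> I0" "j \<in> I0" "i \<noteq> j" for i j
      using cross[of i j] disjoint_of_cover_by_small[OF fin(2), of "F i" "F j"] that sub
      unfolding I0_def by blast
    then have "\<exists>R\<subseteq>I0. card R = r \<and> r \<le> card (V - \<Union> (F ` R))"
      using sub 1 r(2) unfolding I0_def
      by (intro ex_few_sets_small_union[OF I0(2)[unfolded I0_def] fin(2) \<open>0 < k\<close>]) simp_all
    then show ?thesis using I0(1) by blast
  next
    case 2
    let ?G = "\<lambda>i. V - F i"
    have half: "2 * card (?G i) \<le> card V" if "i \<in> I - I0" for i
    proof -
      have i: "i \<in> I" "\<not> 2 * card (F i) \<le> card V" using that unfolding I0_def by auto
      have "card (?G i) = card V - card (F i)"
        by (rule card_Diff_subset[OF finite_subset[OF sub[OF i(1)] fin(2)] sub[OF i(1)]])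
      then show ?thesis using i(2) by linarith
    qed
    have "?G i \<inter> ?G j = {} \<or> card (?G i - ?G j) < k \<or> card (?G j - ?G i) < k"
      if "i \<in> I - I0" "j \<in> I - I0" "i \<noteq> j" for i j
    proof -
      \<comment> \<open>Disjoint large sets have complements that cover \<open>V\<close>; as these
        complements are small, they are disjoint after all.\<close>
      have "?G i \<inter> ?G j = {}" if "?G i \<union> ?G j = V"
        by (rule disjoint_of_cover_by_small[OF fin(2) _ _ half[OF \<open>i \<in> I - I0\<close>]
              half[OF \<open>j \<in> I - I0\<close>] that]) auto
      moreover have "?G i - ?G j = F j - F i" "?G j - ?G i = F i - F j"
        using sub[of i] sub[of j] that by auto
      moreover have "?G i \<union> ?G j = V" if "F i \<inter> F j = {}" using that by auto
      moreover have "?G i \<inter> ?G j = {}" if "F i \<union> F j = V" using that by auto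
      ultimately show ?thesis using cross[of i j] that by auto
    qed
    then have "\<exists>R\<subseteq>I - I0. card R = r \<and> r \<le> card (V - \<Union> (?G ` R))"
      using half 2 r(2)
      by (intro ex_few_sets_small_union[OF I0(3) fin(2) \<open>0 < k\<close>]) (blast | simp)+
    then obtain R where R: "R \<subseteq> I - I0" "card R = r" "r \<le> card (V - \<Union> (?G ` R))"
      by blast
    \<comment> \<open>Points missed by all complements lie in all the sets. Intersecting with
      \<open>V\<close> matters for empty \<open>R\<close>, where the intersection is the whole
      type.\<close>
    moreover have "V - \<Union> (?G ` R) = V \<inter> \<Inter> (F ` R)" by auto
    ultimately show ?thesis by auto
  qed
qed

section \<open>Submatrices\<close>

lemma has_homogeneous_submatrixI:
  assumes "I \<subseteq> {..<dim_row A}" "J \<subseteq> {..<dim_col A}" "card I = s" "card J = t"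
    and "\<And>i j. i \<in> I \<Longrightarrow> j \<in> J \<Longrightarrow> A $$ (i, j) = x"
  shows "has_homogeneous_submatrix A s t"
proof -
  have card: "card {i. i < dim_row A \<and> i \<in> I} = s" "card {j. j < dim_col A \<and> j \<in> J} = t"
    using assms(1-4) by (auto intro!: arg_cong[where f = card])
  have "submatrix A I J \<in> carrier_mat s t" using card by (auto simp: dim_submatrix)
  moreover have "homogeneous (submatrix A I J)"
    unfolding homogeneous_def using card assms(3-5)
    by (auto simp: elements_mat_def dim_submatrix submatrix_index pick_in_set_le)
  ultimately show ?thesis
    using assms(1,2) unfolding has_homogeneous_submatrix_def is_submatrix_def by blast
qed

text \<open>Settles small \<open>n\<close>, where the rounded-up size is at most 1.\<close>

lemma has_homogeneous_submatrix_le_1: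
  assumes "r \<le> 1" "r \<le> dim_row A" "r \<le> dim_col A"
  shows "has_homogeneous_submatrix A r r"
proof (rule has_homogeneous_submatrixI)
  fix i j
  assume "i \<in> {..<r}" "j \<in> {..<r}"
  then have "i = 0" "j = 0" using assms(1) by auto
  then show "A $$ (i, j) = A $$ (0, 0)" by simp
qed (use assms in auto)

lemma bij_betw_pick:
  assumes "finite S"
  shows "bij_betw (pick S) {..<card S} S"
proof -
  have inj: "inj_on (pick S) {..<card S}"
    by (rule linorder_inj_onI) (use pick_mono_le in force)+
  have "pick S ` {..<card S} = S"
    using assms inj by (intro card_subset_eq) (auto simp: pick_in_set_le card_image)
  with inj show ?thesis by (simp add: bij_betw_def)
qed

text \<open>A submatrix lists its indices increasingly through \<open>pick\<close>, while an
  embedding \<open>f\<close> may list them in any order; \<open>p\<close> translates between the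
  two.\<close>

lemma ex_permutes_pick:
  assumes "inj_on f {..<r}"
  shows "\<exists>p. p permutes {..<r} \<and> (\<forall>i<r. pick (f ` {..<r}) (p i) = f i)"
proof -
  let ?S = "f ` {..<r}"
  have card: "card ?S = r" using assms by (simp add: card_image)
  have pick: "bij_betw (pick ?S) {..<r} ?S" using bij_betw_pick[of ?S] card by simp
  \<comment> \<open>Outside the index range \<open>p\<close> is the identity, as
    \<open>permutes\<close> demands.\<close>
  define p where
    "p i = (if i \<in> {..<r} then (inv_into {..<r} (pick ?S) \<circ> f) i else i)" for i
  have "bij_betw f {..<r} ?S" using assms by (simp add: bij_betw_def)
  then have "bij_betw (inv_into {..<r} (pick ?S) \<circ> f) {..<r} {..<r}"
    using bij_betw_inv_into[OF pick] by (rule bij_betw_trans)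
  then have "bij_betw p {..<r} {..<r}"
    by (rule bij_betw_cong[THEN iffD1, rotated]) (simp add: p_def)
  then have "p permutes {..<r}" by (rule bij_imp_permutes) (simp add: p_def)
  moreover have "pick ?S (p i) = f i" if "i < r" for i
    using that bij_betw_inv_into_right[OF pick] by (simp add: p_def)
  ultimately show ?thesis by blast
qed

text \<open>Reduces an unordered copy of \<open>P\<close> to two injections, one on rows and one on
  columns, whose orders are absorbed by the permutations.\<close>

lemma not_unordered_freeI:
  assumes "P \<in> carrier_mat r k" "inj_on f {..<r}" "inj_on g {..<k}"
    and "f ` {..<r} \<subseteq> {..<dim_row A}" "g ` {..<k} \<subseteq> {..<dim_col A}"
    and "\<And>i j. i < r \<Longrightarrow> j < k \<Longrightarrow> P $$ (i, j) = A $$ (f i, g j)"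
  shows "\<not> unordered_free P A"
proof -
  let ?I = "f ` {..<r}" and ?J = "g ` {..<k}"
  let ?B = "submatrix A ?I ?J"
  have "{i. i < dim_row A \<and> i \<in> ?I} = ?I" "{j. j < dim_col A \<and> j \<in> ?J} = ?J"
    using assms(4,5) by blast+
  then have card: "card {i. i < dim_row A \<and> i \<in> ?I} = r" "card {j. j < dim_col A \<and> j \<in> ?J} = k"
    using assms(2,3) by (simp_all add: card_image)
  then have dim: "dim_row ?B = r" "dim_col ?B = k" by (simp_all only: dim_submatrix)
  obtain p where p: "p permutes {..<r}" "\<And>i. i < r \<Longrightarrow> pick ?I (p i) = f i"
    using ex_permutes_pick[OF assms(2)] by blast
  obtain q where q: "q permutes {..<k}" "\<And>j. j < k \<Longrightarrow> pick ?J (q j) = g j"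
    using ex_permutes_pick[OF assms(3)] by blast
  have "P = mat r k (\<lambda>(i, j). ?B $$ (p i, q j))"
  proof (rule eq_matI)
    fix i j
    assume "i < dim_row (mat r k (\<lambda>(i, j). ?B $$ (p i, q j)))"
      and "j < dim_col (mat r k (\<lambda>(i, j). ?B $$ (p i, q j)))"
    then have ij: "i < r" "j < k" by simp_all
    then have "p i < r" "q j < k"
      using permutes_in_image[OF p(1), of i] permutes_in_image[OF q(1), of j] by simp_all
    then have "?B $$ (p i, q j) = A $$ (pick ?I (p i), pick ?J (q j))"
      by (intro submatrix_index) (simp_all only: card)
    then show "P $$ (i, j) = mat r k (\<lambda>(i, j). ?B $$ (p i, q j)) $$ (i, j)"
      using ij p(2) q(2) assms(6) by simp
  qed (use assms(1) in auto)
  then have "permutable_to ?B P"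
    using p(1) q(1) unfolding permutable_to_def dim by blast
  then show ?thesis
    using assms(4,5) unfolding unordered_free_def is_submatrix_def by blast
qed

section \<open>Embedding the columns of the pattern by type\<close>

lemma ex_inj_on_preserving_colour:
  assumes "finite C" "finite D"
    and "\<And>c. c \<in> C \<Longrightarrow> card {c' \<in> C. h c' = h c} \<le> card {d \<in> D. h' d = h c}"
  shows "\<exists>g. inj_on g C \<and> g ` C \<subseteq> D \<and> (\<forall>c\<in>C. h' (g c) = h c)"
proof -
  \<comment> \<open>One injection per colour class. Since \<open>h'\<close> recovers the colour from
    the image, gluing them keeps injectivity.\<close>
  have "\<forall>x\<in>h ` C. \<exists>f. f ` {c \<in> C. h c = x} \<subseteq> {d \<in> D. h' d = x} \<and> inj_on f {c \<in> C. h c = x}"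
    using assms by (intro ballI card_le_inj) auto
  from bchoice[OF this] obtain f where f:
      "\<And>x. x \<in> h ` C \<Longrightarrow> f x ` {c \<in> C. h c = x} \<subseteq> {d \<in> D. h' d = x}"
      "\<And>x. x \<in> h ` C \<Longrightarrow> inj_on (f x) {c \<in> C. h c = x}"
    by auto
  have g: "f (h c) c \<in> D" "h' (f (h c) c) = h c" if "c \<in> C" for c
    using f(1)[of "h c"] that by auto
  have "inj_on (\<lambda>c. f (h c) c) C"
  proof (rule inj_onI)
    fix c c'
    assume c: "c \<in> C" "c' \<in> C" and eq: "f (h c) c = f (h c') c'"
    then have "h c = h c'" using g(2) by metis
    then show "c = c'" using inj_onD[OF f(2)[of "h c"], of c c'] eq c by auto
  qed
  then show ?thesis using g by (intro exI[of _ "\<lambda>c. f (h c) c"]) auto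
qed

text \<open>Two columns constant with the same value would form a homogeneous 2 by 2 block; this is
  how the hypothesis on \<open>P\<close> enters.\<close>

lemma card_constant_columns_le_1:
  assumes "P \<in> carrier_mat 2 k" "\<not> has_homogeneous_submatrix P 2 2"
  shows "card {c \<in> {..<k}. (P $$ (0, c), P $$ (1, c)) = (x, x)} \<le> 1"
proof (rule ccontr)
  let ?C = "{c \<in> {..<k}. (P $$ (0, c), P $$ (1, c)) = (x, x)}"
  assume "\<not> card ?C \<le> 1"
  then have "2 \<le> card ?C" by simp
  then obtain J where J: "J \<subseteq> ?C" "card J = 2" by (rule obtain_subset_with_card_n)
  have "has_homogeneous_submatrix P 2 2"
    by (rule has_homogeneous_submatrixI[of "{..<2}" _ J _ _ x])
      (use assms(1) J in \<open>auto simp: less_2_cases_iff\<close>)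
  with assms(2) show False by contradiction
qed

text \<open>Colour each column by its pair of entries in the two rows. If all four alternatives
  fail, rows \<open>i\<close> and \<open>j\<close> of \<open>A\<close> show both constant colours at
  least once and both mixed colours at least \<open>K\<close> times, which is enough room for all
  columns of \<open>P\<close>.\<close>

lemma cross_free_rows_of_unordered_free:
  fixes A P :: "int mat"
  assumes P: "P \<in> carrier_mat 2 k" "zero_one_mat P" "\<not> has_homogeneous_submatrix P 2 2"
    and A: "zero_one_mat A" "unordered_free P A"
    and ij: "i < dim_row A" "j < dim_row A" "i \<noteq> j" and "k \<le> K"
  defines "F \<equiv> \<lambda>i. {c. c < dim_col A \<and> A $$ (i, c) = 1}"
  shows "F i \<inter> F j = {} \<or> F i \<union> F j = {..<dim_col A} \<or> card (F i - F j) < K \<or> card (F j - F i) < K"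
proof (rule ccontr)
  assume contra: "\<not> ?thesis"
  let ?h = "\<lambda>c. (P $$ (0, c), P $$ (1, c))" and ?h' = "\<lambda>c. (A $$ (i, c), A $$ (j, c))"
  let ?D = "\<lambda>x. {c \<in> {..<dim_col A}. ?h' c = x}"
  have A01: "A $$ (a, c) = 0 \<or> A $$ (a, c) = 1" if "a < dim_row A" "c < dim_col A" for a c
    using A(1) elements_matI[OF _ that, of A] unfolding zero_one_mat_def by auto
  have P01: "P $$ (a, c) = 0 \<or> P $$ (a, c) = 1" if "a < 2" "c < k" for a c
    using P(1,2) elements_matI[of P, OF P(1) that] unfolding zero_one_mat_def by auto
  \<comment> \<open>The four colour classes are the four cells of the Venn diagram of
    \<open>F i\<close> and \<open>F j\<close>.\<close>
  have D: "?D (1, 1) = F i \<inter> F j" "?D (0, 0) = {..<dim_col A} - (F i \<union> F j)"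
    "?D (1, 0) = F i - F j" "?D (0, 1) = F j - F i"
    using A01[OF ij(1)] A01[OF ij(2)] unfolding F_def by fastforce+
  have fin: "finite (F a)" "F a \<subseteq> {..<dim_col A}" for a unfolding F_def by auto
  have const: "1 \<le> card (?D (x, x))" if "x = 0 \<or> x = 1" for x
  proof -
    have "?D (x, x) \<noteq> {}" using that contra fin(2) D(1,2) by blast
    then show ?thesis by (simp add: Suc_le_eq card_gt_0_iff)
  qed
  have "\<exists>g. inj_on g {..<k} \<and> g ` {..<k} \<subseteq> {..<dim_col A} \<and> (\<forall>c\<in>{..<k}. ?h' (g c) = ?h c)"
  proof (rule ex_inj_on_preserving_colour)
    fix c
    assume "c \<in> {..<k}"
    then have "P $$ (0, c) = 0 \<or> P $$ (0, c) = 1" "P $$ (1, c) = 0 \<or> P $$ (1, c) = 1"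
      using P01 by auto
    then consider x where "?h c = (x, x)" "x = 0 \<or> x = 1" | "?h c = (1, 0)" | "?h c = (0, 1)"
      by force
    then show "card {c' \<in> {..<k}. ?h c' = ?h c} \<le> card (?D (?h c))"
    proof cases
      case 1
      then show ?thesis
        using card_constant_columns_le_1[OF P(1,3), of x] const[of x] by simp
    next
      case 2
      \<comment> \<open>For mixed colours the crude bound by all \<open>k\<close> columns suffices,
        as \<open>k \<le> K\<close>.\<close>
      have "card {c' \<in> {..<k}. ?h c' = ?h c} \<le> card {..<k}" by (intro card_mono) auto
      then show ?thesis using contra D(3) \<open>k \<le> K\<close> unfolding 2 by simp
    next
      case 3
      have "card {c' \<in> {..<k}. ?h c' = ?h c} \<le> card {..<k}" by (intro card_mono) auto
      then show ?thesis using contra D(4) \<open>k \<le> K\<close> unfolding 3 by simp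
    qed
  qed auto
  then obtain g where g: "inj_on g {..<k}" "g ` {..<k} \<subseteq> {..<dim_col A}"
    "\<And>c. c < k \<Longrightarrow> ?h' (g c) = ?h c" by auto
  have "\<not> unordered_free P A"
    by (rule not_unordered_freeI[OF P(1) _ g(1) _ g(2), of "\<lambda>a. if a = 0 then i else j"])
      (use ij g(3) in \<open>auto simp: inj_on_def less_2_cases_iff split: if_splits\<close>)
  with A(2) show False by contradiction
qed

section \<open>From cross-free rows to a homogeneous submatrix of linear size\<close>

theorem theorem1p6:
  fixes P :: "int mat" and k :: nat
  assumes "P \<in> carrier_mat 2 k"
    and "zero_one_mat P"
    and "\<not> has_homogeneous_submatrix P 2 2"
  shows "\<exists>c::real. c > 0 \<and>
    (\<forall>(n::nat) (A::int mat).
       A \<in> carrier_mat n n \<longrightarrow> zero_one_mat A \<longrightarrow> unordered_free P A \<longrightarrow>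
       has_homogeneous_submatrix A (nat \<lceil>c * real n\<rceil>) (nat \<lceil>c * real n\<rceil>))"
proof (intro exI[of _ "1 / (8 * real (Suc k))"] conjI allI impI)
  show "0 < 1 / (8 * real (Suc k))" by simp
  fix n :: nat and A :: "int mat"
  assume A: "A \<in> carrier_mat n n" "zero_one_mat A" "unordered_free P A"
  \<comment> \<open>The successor keeps \<open>K\<close> positive even when
    \<open>k = 0\<close>.\<close>
  define K where "K = Suc k"
  define r where "r = nat \<lceil>1 / (8 * real K) * real n\<rceil>"
  have "K > 0" by (simp add: K_def)
  have dims: "dim_row A = n" "dim_col A = n" using A(1) by auto
  have "has_homogeneous_submatrix A r r"
  proof (cases "n < 8 * K")
    case True
    then have "1 / (8 * real K) * real n \<le> 1" by (simp add: field_simps)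
    then have "r \<le> 1" unfolding r_def by (simp add: ceiling_le_one)
    \<comment> \<open>The empty matrix has no room for a 1 by 1 submatrix.\<close>
    moreover have "r = 0" if "n = 0" using that unfolding r_def by simp
    ultimately show ?thesis
      using dims by (intro has_homogeneous_submatrix_le_1) (cases n; simp)+
  next
    case False
    \<comment> \<open>The rectangle lemma needs \<open>4 * K * r \<le> n\<close>. The constant has 8
      in place of 4 to absorb rounding: for \<open>n \<ge> 8 * K\<close> the added 1 is at most
      n/(8K).\<close>
    have "real r \<le> 1 / (8 * real K) * real n + 1" unfolding r_def by simp
    then have "8 * real K * real r \<le> 8 * real K * (1 / (8 * real K) * real n + 1)"
      by (intro mult_left_mono) auto
    also have "\<dots> = real n + 8 * real K" using \<open>K > 0\<close> by (simp add: field_simps)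
    also have "\<dots> \<le> 2 * real n" using False by simp
    finally have "real (4 * K * r) \<le> real n" by simp
    then have Kr: "4 * K * r \<le> n" by (simp only: of_nat_le_iff)
    moreover have "r \<le> K * r" using \<open>K > 0\<close> by simp
    ultimately have "4 * r \<le> n" by linarith
    let ?F = "\<lambda>i. {c. c < n \<and> A $$ (i, c) = 1}"
    have "?F i \<inter> ?F j = {} \<or> ?F i \<union> ?F j = {..<n} \<or> card (?F i - ?F j) < K \<or> card (?F j - ?F i) < K"
      if "i < n" "j < n" "i \<noteq> j" for i j
      using cross_free_rows_of_unordered_free[OF assms A(2,3), of i j K] that
      unfolding dims K_def by simp
    then have "\<exists>R\<subseteq>{..<n}. card R = r \<and>
        (r \<le> card ({..<n} - \<Union> (?F ` R)) \<or> r \<le> card ({..<n} \<inter> \<Inter> (?F ` R)))"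
      using \<open>K > 0\<close> \<open>4 * r \<le> n\<close> Kr
      by (intro ex_large_rectangle_of_cross_free[where k = K]) auto
    then obtain R where R: "R \<subseteq> {..<n}" "card R = r"
      "r \<le> card ({..<n} - \<Union> (?F ` R)) \<or> r \<le> card ({..<n} \<inter> \<Inter> (?F ` R))"
      by blast
    have A01: "A $$ (a, c) = 0 \<or> A $$ (a, c) = 1" if "a < n" "c < n" for a c
      using A(2) elements_matI[OF A(1) that] unfolding zero_one_mat_def by auto
    \<comment> \<open>Columns outside all row sets give zeros, columns common to all of them give
      ones.\<close>
    obtain V x where V: "V \<subseteq> {..<n}" "r \<le> card V" "\<And>i c. i \<in> R \<Longrightarrow> c \<in> V \<Longrightarrow> A $$ (i, c) = x"
    proof (rule disjE[OF R(3)])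
      assume "r \<le> card ({..<n} - \<Union> (?F ` R))"
      then show thesis
        using A01 R(1) by (intro that[of "{..<n} - \<Union> (?F ` R)" 0]) auto
    next
      assume "r \<le> card ({..<n} \<inter> \<Inter> (?F ` R))"
      then show thesis by (intro that[of "{..<n} \<inter> \<Inter> (?F ` R)" 1]) auto
    qed
    obtain J where "J \<subseteq> V" "card J = r" using obtain_subset_with_card_n[OF V(2)] by blast
    then show ?thesis
      using R V dims by (intro has_homogeneous_submatrixI[of R _ J _ _ x]) auto
  qed
  then show "has_homogeneous_submatrix A (nat \<lceil>1 / (8 * real (Suc k)) * real n\<rceil>)
      (nat \<lceil>1 / (8 * real (Suc k)) * real n\<rceil>)"
    unfolding r_def K_def .
qed

end
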